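(* Let $\eta=\frac12+\frac{\sqrt3}{2}i$. In the maximally entangled three player, two strategy EWL quantized game (described in the context), suppose players 1, 2 and 3 play the pure quantum strategies given respectively by the $SU(2)$ matrices $$U_1=\begin{pmatrix}A&B\\-\bar B&\bar A\end{pmatrix},\qquad U_2=\begin{pmatrix}P&Q\\-\bar Q&\bar P\end{pmatrix},\qquad U_3=\begin{pmatrix}E&F\\-\bar F&\bar E\end{pmatrix},$$ where $A=a_0+a_1i$, $B=b_0+b_1i$, $P=p_0+p_1i$, $Q=q_0+q_1i$, $E=e_0+e_1i$, $F=f_0+f_1i$ are complex numbers (with $a_0,a_1,\dots,f_0,f_1$ real) satisfying $|A|^2+|B|^2=|P|^2+|Q|^2=|E|^2+|F|^2=1$. Let $s_{\alpha\beta},t_{\alpha\beta},u_{\alpha\beta}$ ($\alpha,\beta\in\{0,1\}$) be the unit octonions associated with these strategies, as defined in the context. Then the probability distribution over the outcomes $NNN,NNF,NFN,NFF,FNN,FNF,FFN,FFF$ is given by $$pr(NNN)=\left[\pi_0\left(\tfrac{(s_{10}t_{10})u_{01}+(s_{01}t_{10})u_{01}}{2}\right)\right]^2+\left[\pi_0\left(\tfrac{(s_{10}t_{10})u_{01}-(s_{01}t_{10})u_{01}}{2}\right)\right]^2,$$ $$pr(FFF)=\left[\pi_1\left(\tfrac{(s_{10}t_{10})u_{01}+(s_{01}t_{10})u_{01}}{2}\right)\right]^2+\left[\pi_1\left(\tfrac{(s_{10}t_{10})u_{01}-(s_{01}t_{10})u_{01}}{2}\right)\right]^2,$$ $$pr(NFF)=\left[\pi_2\left(\tfrac{(s_{01}t_{00})u_{00}+(s_{10}t_{00})u_{00}}{2}\right)\right]^2+\left[\pi_2\left(\tfrac{(s_{01}t_{00})u_{00}-(s_{10}t_{00})u_{00}}{2}\right)\right]^2,$$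 $$pr(FNN)=\left[\pi_4\left(\tfrac{(s_{01}t_{00})u_{00}+(s_{10}t_{00})u_{00}}{2}\right)\right]^2+\left[\pi_4\left(\tfrac{(s_{01}t_{00})u_{00}-(s_{10}t_{00})u_{00}}{2}\right)\right]^2,$$ $$pr(FNF)=\left[\pi_5\left(\tfrac{(s_{01}t_{00})u_{00}+(s_{10}t_{00})u_{00}}{2}\right)\right]^2+\left[\pi_5\left(\tfrac{(s_{01}t_{00})u_{00}-(s_{10}t_{00})u_{00}}{2}\right)\right]^2,$$ $$pr(NFN)=\left[\pi_6\left(\tfrac{(s_{01}t_{00})u_{00}+(s_{10}t_{00})u_{00}}{2}\right)\right]^2+\left[\pi_6\left(\tfrac{(s_{01}t_{00})u_{00}-(s_{10}t_{00})u_{00}}{2}\right)\right]^2,$$ $$pr(FFN)=\left[\pi_3\left(\tfrac{(s_{10}t_{10})u_{01}+(s_{01}t_{10})u_{01}}{2}\right)\right]^2+\left[\pi_3\left(\tfrac{(s_{10}t_{10})u_{01}-(s_{01}t_{10})u_{01}}{2}\right)\right]^2,$$ $$pr(NNF)=\left[\pi_7\left(\tfrac{(s_{10}t_{10})u_{01}+(s_{01}t_{10})u_{01}}{2}\right)\right]^2+\left[\pi_7\left(\tfrac{(s_{10}t_{10})u_{01}-(s_{01}t_{10})u_{01}}{2}\right)\right]^2,$$ where $\pi_j$ is the projection of an octonion onto the real subspace spanned by $i_j$, with $i_0=1$ (so $[\pi_j(x)]^2$ denotes the square of the real coefficient of $i_j$ in $x$).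
   Context: **The game.** Each of three players holds one qubit, with state space $\mathbb{C}^2$ and orthonormal basis $|0\rangle=(1,0)^T$, $|1\rangle=(0,1)^T$; the joint state space is $\mathbb{C}^2\otimes\mathbb{C}^2\otimes\mathbb{C}^2$ with orthonormal basis $|abc\rangle=|a\rangle\otimes|b\rangle\otimes|c\rangle$, $a,b,c\in\{0,1\}$. A referee prepares the maximally entangled state $|000\rangle+|111\rangle$ (normalized: $\psi_0=\frac1{\sqrt2}(|000\rangle+|111\rangle)$). A pure quantum strategy of a player is an element of $SU(2)$, acting on that player's qubit (as a matrix on column vectors). If players 1, 2, 3 use $U_1,U_2,U_3$, the resulting joint state is $(U_1\otimes U_2\otimes U_3)\psi_0$. The two classical pure strategies, "no flip" $N$ and "flip" $F$, are represented by the matrices $$N=\begin{pmatrix}1&0\\0&1\end{pmatrix},\qquad F=\begin{pmatrix}0&\eta\\-\bar\eta&0\end{pmatrix},\qquad \eta=\tfrac12+\tfrac{\sqrt3}{2}i.$$ (The letter $F$ is also used for the upper right entry of player 3's matrix $U_3$; in outcome names such as $NFF$ it always means "flip".) For $X,Y,Z\in\{N,F\}$ the outcome state $XYZ$ is the state $(X\otimes Y\otimes Z)\psi_0$, where $X,Y,Z$ are the choices of players 1, 2, 3 respectively. For this $\eta$ the eight outcome states form an orthonormal basis of the joint state space. The referee measures the final state in this basis, so $$pr(XYZ)=\left|\left\langle (X\otimes Y\otimes Z)\psi_0,\ (U_1\otimes U_2\otimes U_3)\psi_0\right\rangle\right|^2 .$$ **Octonions.** $\mathbb{O}$ is the 8-dimensional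 real (non-associative) division algebra with basis $1=i_0,i_1,\dots,i_7$, where $i_j^2=-1$ for $1\le j\le7$, and for each of the cyclically ordered triples $$(j,k,l)\in\{(1,2,4),(2,3,5),(3,4,6),(4,5,7),(5,6,1),(6,7,2),(7,1,3)\}$$ one has $i_ji_k=i_l=-i_ki_j$, $i_ki_l=i_j=-i_li_k$, $i_li_j=i_k=-i_ji_l$. Complex numbers are regarded as octonions through $x_0+x_1i\mapsto x_0+x_1i_1$. **Octonions attached to strategies.** For the strategies $U_1,U_2,U_3$ with entries as in the claim, define $$s_{00}=A+B\bar\eta\, i_4=a_0+a_1i_1+\left(\tfrac{\sqrt3}{2}b_0-\tfrac12b_1\right)i_2+\left(\tfrac12b_0+\tfrac{\sqrt3}{2}b_1\right)i_4,$$ $$t_{00}=P+Q\bar\eta\, i_6=p_0+p_1i_1+\left(\tfrac{\sqrt3}{2}q_0-\tfrac12q_1\right)i_5+\left(\tfrac12q_0+\tfrac{\sqrt3}{2}q_1\right)i_6,$$ $$u_{00}=E+F\bar\eta\, i_7=e_0+e_1i_1+\left(\tfrac{\sqrt3}{2}f_0-\tfrac12f_1\right)i_3+\left(\tfrac12f_0+\tfrac{\sqrt3}{2}f_1\right)i_7.$$ For $\alpha,\beta\in\{0,1\}$, $s_{\alpha\beta}$ is obtained from $s_{00}$ by replacing $a_0$ with $(-1)^\alpha a_0$ and $a_1$ with $(-1)^\beta a_1$, leaving the other coefficients unchanged. Likewise $t_{\alpha\beta}$ is obtained from $t_{00}$ by replacing $p_0,p_1$ with $(-1)^\alpha p_0,(-1)^\beta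 p_1$, and $u_{\alpha\beta}$ from $u_{00}$ by replacing $e_0,e_1$ with $(-1)^\alpha e_0,(-1)^\beta e_1$. *)

theory Defs
  imports "HOL-Analysis.Analysis"
begin

section \<open>Octonions\<close>

datatype octonion =
  Octonion (\<pi>\<^sub>0: real) (\<pi>\<^sub>1: real) (\<pi>\<^sub>2: real) (\<pi>\<^sub>3: real)
           (\<pi>\<^sub>4: real) (\<pi>\<^sub>5: real) (\<pi>\<^sub>6: real) (\<pi>\<^sub>7: real)

instantiation octonion :: real_vector
begin

definition "0 = Octonion 0 0 0 0 0 0 0 0"

definition "x + y =
  Octonion (\<pi>\<^sub>0 x + \<pi>\<^sub>0 y) (\<pi>\<^sub>1 x + \<pi>\<^sub>1 y) (\<pi>\<^sub>2 x + \<pi>\<^sub>2 y) (\<pi>\<^sub>3 x + \<pi>\<^sub>3 y)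
           (\<pi>\<^sub>4 x + \<pi>\<^sub>4 y) (\<pi>\<^sub>5 x + \<pi>\<^sub>5 y) (\<pi>\<^sub>6 x + \<pi>\<^sub>6 y) (\<pi>\<^sub>7 x + \<pi>\<^sub>7 y)"

definition "x - y =
  Octonion (\<pi>\<^sub>0 x - \<pi>\<^sub>0 y) (\<pi>\<^sub>1 x - \<pi>\<^sub>1 y) (\<pi>\<^sub>2 x - \<pi>\<^sub>2 y) (\<pi>\<^sub>3 x - \<pi>\<^sub>3 y)
           (\<pi>\<^sub>4 x - \<pi>\<^sub>4 y) (\<pi>\<^sub>5 x - \<pi>\<^sub>5 y) (\<pi>\<^sub>6 x - \<pi>\<^sub>6 y) (\<pi>\<^sub>7 x - \<pi>\<^sub>7 y)"

definition "- x =
  Octonion (- \<pi>\<^sub>0 x) (- \<pi>\<^sub>1 x) (- \<pi>\<^sub>2 x) (- \<pi>\<^sub>3 x) (- \<pi>\<^sub>4 x) (- \<pi>\<^sub>5 x) (- \<pi>\<^sub>6 x) (- \<pi>\<^sub>7 x)"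

definition "r *\<^sub>R x =
  Octonion (r * \<pi>\<^sub>0 x) (r * \<pi>\<^sub>1 x) (r * \<pi>\<^sub>2 x) (r * \<pi>\<^sub>3 x)
           (r * \<pi>\<^sub>4 x) (r * \<pi>\<^sub>5 x) (r * \<pi>\<^sub>6 x) (r * \<pi>\<^sub>7 x)"

instance
  by standard
    (auto simp: zero_octonion_def plus_octonion_def minus_octonion_def uminus_octonion_def
       scaleR_octonion_def algebra_simps)

end

text \<open>
  The product is the bilinear extension of the multiplication table of the units
  (lemmas \<open>bilinear_octonion_times\<close>, \<open>octonion_unit\<close>, \<open>octonion_square\<close> and
  \<open>octonion_triples\<close> below).
\<close>

instantiation octonion :: "{one, times}"
begin

definition "1 = Octonion 1 0 0 0 0 0 0 0"

definition "x * y = Octonion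
  (\<pi>\<^sub>0 x * \<pi>\<^sub>0 y - \<pi>\<^sub>1 x * \<pi>\<^sub>1 y - \<pi>\<^sub>2 x * \<pi>\<^sub>2 y - \<pi>\<^sub>3 x * \<pi>\<^sub>3 y
    - \<pi>\<^sub>4 x * \<pi>\<^sub>4 y - \<pi>\<^sub>5 x * \<pi>\<^sub>5 y - \<pi>\<^sub>6 x * \<pi>\<^sub>6 y - \<pi>\<^sub>7 x * \<pi>\<^sub>7 y)
  (\<pi>\<^sub>0 x * \<pi>\<^sub>1 y + \<pi>\<^sub>1 x * \<pi>\<^sub>0 y + \<pi>\<^sub>2 x * \<pi>\<^sub>4 y + \<pi>\<^sub>3 x * \<pi>\<^sub>7 y
    - \<pi>\<^sub>4 x * \<pi>\<^sub>2 y + \<pi>\<^sub>5 x * \<pi>\<^sub>6 y - \<pi>\<^sub>6 x * \<pi>\<^sub>5 y - \<pi>\<^sub>7 x * \<pi>\<^sub>3 y)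
  (\<pi>\<^sub>0 x * \<pi>\<^sub>2 y - \<pi>\<^sub>1 x * \<pi>\<^sub>4 y + \<pi>\<^sub>2 x * \<pi>\<^sub>0 y + \<pi>\<^sub>3 x * \<pi>\<^sub>5 y
    + \<pi>\<^sub>4 x * \<pi>\<^sub>1 y - \<pi>\<^sub>5 x * \<pi>\<^sub>3 y + \<pi>\<^sub>6 x * \<pi>\<^sub>7 y - \<pi>\<^sub>7 x * \<pi>\<^sub>6 y)
  (\<pi>\<^sub>0 x * \<pi>\<^sub>3 y - \<pi>\<^sub>1 x * \<pi>\<^sub>7 y - \<pi>\<^sub>2 x * \<pi>\<^sub>5 y + \<pi>\<^sub>3 x * \<pi>\<^sub>0 y
    + \<pi>\<^sub>4 x * \<pi>\<^sub>6 y + \<pi>\<^sub>5 x * \<pi>\<^sub>2 y - \<pi>\<^sub>6 x * \<pi>\<^sub>4 y + \<pi>\<^sub>7 x * \<pi>\<^sub>1 y)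
  (\<pi>\<^sub>0 x * \<pi>\<^sub>4 y + \<pi>\<^sub>1 x * \<pi>\<^sub>2 y - \<pi>\<^sub>2 x * \<pi>\<^sub>1 y - \<pi>\<^sub>3 x * \<pi>\<^sub>6 y
    + \<pi>\<^sub>4 x * \<pi>\<^sub>0 y + \<pi>\<^sub>5 x * \<pi>\<^sub>7 y + \<pi>\<^sub>6 x * \<pi>\<^sub>3 y - \<pi>\<^sub>7 x * \<pi>\<^sub>5 y)
  (\<pi>\<^sub>0 x * \<pi>\<^sub>5 y - \<pi>\<^sub>1 x * \<pi>\<^sub>6 y + \<pi>\<^sub>2 x * \<pi>\<^sub>3 y - \<pi>\<^sub>3 x * \<pi>\<^sub>2 y
    - \<pi>\<^sub>4 x * \<pi>\<^sub>7 y + \<pi>\<^sub>5 x * \<pi>\<^sub>0 y + \<pi>\<^sub>6 x * \<pi>\<^sub>1 y + \<pi>\<^sub>7 x * \<pi>\<^sub>4 y)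
  (\<pi>\<^sub>0 x * \<pi>\<^sub>6 y + \<pi>\<^sub>1 x * \<pi>\<^sub>5 y - \<pi>\<^sub>2 x * \<pi>\<^sub>7 y + \<pi>\<^sub>3 x * \<pi>\<^sub>4 y
    - \<pi>\<^sub>4 x * \<pi>\<^sub>3 y - \<pi>\<^sub>5 x * \<pi>\<^sub>1 y + \<pi>\<^sub>6 x * \<pi>\<^sub>0 y + \<pi>\<^sub>7 x * \<pi>\<^sub>2 y)
  (\<pi>\<^sub>0 x * \<pi>\<^sub>7 y + \<pi>\<^sub>1 x * \<pi>\<^sub>3 y + \<pi>\<^sub>2 x * \<pi>\<^sub>6 y - \<pi>\<^sub>3 x * \<pi>\<^sub>1 y
    + \<pi>\<^sub>4 x * \<pi>\<^sub>5 y - \<pi>\<^sub>5 x * \<pi>\<^sub>4 y - \<pi>\<^sub>6 x * \<pi>\<^sub>2 y + \<pi>\<^sub>7 x * \<pi>\<^sub>0 y)"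

instance ..

end

definition i\<^sub>1 :: octonion where "i\<^sub>1 = Octonion 0 1 0 0 0 0 0 0"
definition i\<^sub>2 :: octonion where "i\<^sub>2 = Octonion 0 0 1 0 0 0 0 0"
definition i\<^sub>3 :: octonion where "i\<^sub>3 = Octonion 0 0 0 1 0 0 0 0"
definition i\<^sub>4 :: octonion where "i\<^sub>4 = Octonion 0 0 0 0 1 0 0 0"
definition i\<^sub>5 :: octonion where "i\<^sub>5 = Octonion 0 0 0 0 0 1 0 0"
definition i\<^sub>6 :: octonion where "i\<^sub>6 = Octonion 0 0 0 0 0 0 1 0"
definition i\<^sub>7 :: octonion where "i\<^sub>7 = Octonion 0 0 0 0 0 0 0 1"

lemmas octonion_defs =
  zero_octonion_def plus_octonion_def minus_octonion_def uminus_octonion_def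
  scaleR_octonion_def one_octonion_def times_octonion_def
  i\<^sub>1_def i\<^sub>2_def i\<^sub>3_def i\<^sub>4_def i\<^sub>5_def i\<^sub>6_def i\<^sub>7_def

lemma bilinear_octonion_times: "bilinear ((*) :: octonion \<Rightarrow> octonion \<Rightarrow> octonion)"
  unfolding bilinear_def
  by (auto intro!: linearI simp: octonion_defs algebra_simps)

lemma octonion_unit: "1 * x = x" "x * 1 = x" for x :: octonion
  by (cases x; simp add: octonion_defs)+

lemma octonion_square:
  "i\<^sub>1 * i\<^sub>1 = -1" "i\<^sub>2 * i\<^sub>2 = -1" "i\<^sub>3 * i\<^sub>3 = -1" "i\<^sub>4 * i\<^sub>4 = -1"
  "i\<^sub>5 * i\<^sub>5 = -1" "i\<^sub>6 * i\<^sub>6 = -1" "i\<^sub>7 * i\<^sub>7 = -1"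
  by (simp_all add: octonion_defs)

definition octonion_triple :: "octonion \<Rightarrow> octonion \<Rightarrow> octonion \<Rightarrow> bool" where
  "octonion_triple x y z \<longleftrightarrow>
     x * y = z \<and> y * x = - z \<and> y * z = x \<and> z * y = - x \<and> z * x = y \<and> x * z = - y"

lemma octonion_triples:
  "octonion_triple i\<^sub>1 i\<^sub>2 i\<^sub>4" "octonion_triple i\<^sub>2 i\<^sub>3 i\<^sub>5" "octonion_triple i\<^sub>3 i\<^sub>4 i\<^sub>6"
  "octonion_triple i\<^sub>4 i\<^sub>5 i\<^sub>7" "octonion_triple i\<^sub>5 i\<^sub>6 i\<^sub>1" "octonion_triple i\<^sub>6 i\<^sub>7 i\<^sub>2"
  "octonion_triple i\<^sub>7 i\<^sub>1 i\<^sub>3"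
  by (simp_all add: octonion_triple_def octonion_defs)

definition oct_of_complex :: "complex \<Rightarrow> octonion" where
  "oct_of_complex z = Re z *\<^sub>R 1 + Im z *\<^sub>R i\<^sub>1"


section \<open>The three-player game\<close>

type_synonym qubit = "complex^2"
type_synonym joint_state = "complex^(2 \<times> 2 \<times> 2)"

definition cinner :: "complex^'n \<Rightarrow> complex^'n \<Rightarrow> complex" where
  "cinner x y = (\<Sum>k\<in>UNIV. cnj (x $ k) * y $ k)"

definition tensor_vec :: "complex^'m \<Rightarrow> complex^'n \<Rightarrow> complex^('m \<times> 'n)" (infixr "\<otimes>\<^sub>v" 75) where
  "x \<otimes>\<^sub>v y = (\<chi> k. x $ fst k * y $ snd k)"

definition tensor_mat :: "complex^'m^'m \<Rightarrow> complex^'n^'n \<Rightarrow> complex^('m \<times> 'n)^('m \<times> 'n)"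
    (infixr "\<otimes>\<^sub>m" 75) where
  "X \<otimes>\<^sub>m Y = (\<chi> k l. X $ fst k $ fst l * Y $ snd k $ snd l)"

lemma tensor_mat_vec: "(X \<otimes>\<^sub>m Y) *v (x \<otimes>\<^sub>v y) = (X *v x) \<otimes>\<^sub>v (Y *v y)"
  by (simp add: vec_eq_iff tensor_mat_def tensor_vec_def matrix_vector_mult_def sum_product
      sum.cartesian_product mult_ac flip: UNIV_Times_UNIV) (simp add: case_prod_beta)

definition ket0 :: qubit where "ket0 = vector [1, 0]"
definition ket1 :: qubit where "ket1 = vector [0, 1]"

definition initial_state :: joint_state where
  "initial_state = (1 / sqrt 2) *\<^sub>R (ket0 \<otimes>\<^sub>v ket0 \<otimes>\<^sub>v ket0 + ket1 \<otimes>\<^sub>v ket1 \<otimes>\<^sub>v ket1)"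

definition SU2 :: "(complex^2^2) set" where
  "SU2 = {U. map_matrix cnj (transpose U) ** U = mat 1 \<and> det U = 1}"

lemma in_SU2:
  assumes "(cmod a)\<^sup>2 + (cmod b)\<^sup>2 = 1"
  shows "vector [vector [a, b], vector [- cnj b, cnj a]] \<in> SU2"
proof -
  have "complex_of_real ((cmod a)\<^sup>2 + (cmod b)\<^sup>2) = 1" using assms by simp
  hence *: "a * cnj a + b * cnj b = 1" by (simp only: complex_norm_square of_real_add)
  show ?thesis
    using * by (auto simp: SU2_def vec_eq_iff forall_2 map_matrix_def
        matrix_matrix_mult_def transpose_def mat_def sum_2 det_2 vector_2 mult_ac add_ac)
qed

definition eta :: complex where "eta = Complex (1/2) (sqrt 3 / 2)"

datatype move = NoFlip | Flip

fun move_matrix :: "move \<Rightarrow> complex^2^2" where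
  "move_matrix NoFlip = vector [vector [1, 0], vector [0, 1]]"
| "move_matrix Flip = vector [vector [0, eta], vector [- cnj eta, 0]]"

definition final_state :: "complex^2^2 \<Rightarrow> complex^2^2 \<Rightarrow> complex^2^2 \<Rightarrow> joint_state" where
  "final_state U V W = (U \<otimes>\<^sub>m V \<otimes>\<^sub>m W) *v initial_state"

definition outcome_state :: "move \<Rightarrow> move \<Rightarrow> move \<Rightarrow> joint_state" where
  "outcome_state X Y Z = final_state (move_matrix X) (move_matrix Y) (move_matrix Z)"

definition pr :: "complex^2^2 \<Rightarrow> complex^2^2 \<Rightarrow> complex^2^2 \<Rightarrow> move \<Rightarrow> move \<Rightarrow> move \<Rightarrow> real" where
  "pr U V W X Y Z = (cmod (cinner (outcome_state X Y Z) (final_state U V W)))\<^sup>2"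


lemma sum_qubits: "(\<Sum>k\<in>UNIV. f k) =
    f (1, 1, 1) + f (1, 1, 2) + f (1, 2, 1) + f (1, 2, 2) +
    f (2, 1, 1) + f (2, 1, 2) + f (2, 2, 1) + f (2, 2, 2)"
  for f :: "2 \<times> 2 \<times> 2 \<Rightarrow> 'a::comm_monoid_add"
  by (simp add: sum.cartesian_product' sum_2 add_ac flip: UNIV_Times_UNIV)

lemma final_state_nth:
  "final_state U V W $ (a, b, c) =
     (U $ a $ 1 * V $ b $ 1 * W $ c $ 1 + U $ a $ 2 * V $ b $ 2 * W $ c $ 2) / sqrt 2"
proof -
  have "(U \<otimes>\<^sub>m V \<otimes>\<^sub>m W) *v (x \<otimes>\<^sub>v y \<otimes>\<^sub>v z) = (U *v x) \<otimes>\<^sub>v (V *v y) \<otimes>\<^sub>v (W *v z)" for x y z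
    by (simp add: tensor_mat_vec)
  moreover have "M *v (r *\<^sub>R x) = r *\<^sub>R (M *v x)" for M :: "complex^(2 \<times> 2 \<times> 2)^(2 \<times> 2 \<times> 2)" and r x
    by (simp add: vec_eq_iff matrix_vector_mult_def scaleR_sum_right)
  ultimately have "final_state U V W = (1 / sqrt 2) *\<^sub>R
      ((U *v ket0) \<otimes>\<^sub>v (V *v ket0) \<otimes>\<^sub>v (W *v ket0) + (U *v ket1) \<otimes>\<^sub>v (V *v ket1) \<otimes>\<^sub>v (W *v ket1))"
    by (simp add: final_state_def initial_state_def
        matrix_vector_right_distrib)
  thus ?thesis
    by (simp add: tensor_vec_def matrix_vector_mult_def ket0_def ket1_def sum_2 vector_2)
      (simp add: scaleR_conv_of_real field_simps)
qed

lemma cinner_final_state: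
  "cinner (final_state U V W) (final_state U' V' W') =
     (\<Sum>(a, b, c)\<in>UNIV.
        cnj (U $ a $ 1 * V $ b $ 1 * W $ c $ 1 + U $ a $ 2 * V $ b $ 2 * W $ c $ 2)
        * (U' $ a $ 1 * V' $ b $ 1 * W' $ c $ 1 + U' $ a $ 2 * V' $ b $ 2 * W' $ c $ 2)) / 2"
proof -
  have s: "complex_of_real (sqrt 2) * complex_of_real (sqrt 2) = 2"
    by (simp flip: of_real_mult)
  show ?thesis
    unfolding cinner_def
    by (subst sum_divide_distrib, rule sum.cong) (auto simp: final_state_nth s simp del: complex_cnj_add complex_cnj_mult)
qed

lemma outcome_states_orthonormal:
  "cinner (outcome_state X Y Z) (outcome_state X' Y' Z') =
     (if X = X' \<and> Y = Y' \<and> Z = Z' then 1 else 0)"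
proof -
  have e: "eta * cnj eta = 1"
    by (simp add: eta_def complex_eq_iff)
  have e3: "eta * (eta * eta) = -1" "cnj eta * (cnj eta * cnj eta) = -1"
    by (simp_all add: eta_def complex_eq_iff algebra_simps)
  have e': "eta * (cnj eta * z) = z" "cnj eta * (eta * z) = z" "cnj eta * eta = 1"
           "eta * (eta * (eta * z)) = - z" "cnj eta * (cnj eta * (cnj eta * z)) = - z" for z
    using e e3 by (metis mult.assoc mult.commute mult_1 mult_minus_left)+
  show ?thesis
    unfolding outcome_state_def cinner_final_state
    by (cases X; cases Y; cases Z; cases X'; cases Y'; cases Z';
        simp add: sum_qubits vector_2 mult.assoc e e3 e')
qed


section \<open>Octonions attached to strategies\<close>

definition flip_signs :: "nat \<Rightarrow> nat \<Rightarrow> complex \<Rightarrow> complex" where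
  "flip_signs \<alpha> \<beta> z = Complex ((-1) ^ \<alpha> * Re z) ((-1) ^ \<beta> * Im z)"

text \<open>The indices \<open>\<alpha>\<close> and \<open>\<beta>\<close> are meant to range over \<open>{0, 1}\<close>.\<close>

definition oct_s :: "complex \<Rightarrow> complex \<Rightarrow> nat \<Rightarrow> nat \<Rightarrow> octonion" where
  "oct_s A B \<alpha> \<beta> = oct_of_complex (flip_signs \<alpha> \<beta> A) + oct_of_complex (B * cnj eta) * i\<^sub>4"

definition oct_t :: "complex \<Rightarrow> complex \<Rightarrow> nat \<Rightarrow> nat \<Rightarrow> octonion" where
  "oct_t P Q \<alpha> \<beta> = oct_of_complex (flip_signs \<alpha> \<beta> P) + oct_of_complex (Q * cnj eta) * i\<^sub>6"

definition oct_u :: "complex \<Rightarrow> complex \<Rightarrow> nat \<Rightarrow> nat \<Rightarrow> octonion" where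
  "oct_u E F \<alpha> \<beta> = oct_of_complex (flip_signs \<alpha> \<beta> E) + oct_of_complex (F * cnj eta) * i\<^sub>7"

lemma oct_s_coordinates:
  "oct_s (Complex a0 a1) (Complex b0 b1) \<alpha> \<beta> =
     ((-1) ^ \<alpha> * a0) *\<^sub>R 1 + ((-1) ^ \<beta> * a1) *\<^sub>R i\<^sub>1
     + (sqrt 3 / 2 * b0 - 1/2 * b1) *\<^sub>R i\<^sub>2 + (1/2 * b0 + sqrt 3 / 2 * b1) *\<^sub>R i\<^sub>4"
  by (simp add: oct_s_def oct_of_complex_def flip_signs_def eta_def octonion_defs)

lemma oct_t_coordinates:
  "oct_t (Complex p0 p1) (Complex q0 q1) \<alpha> \<beta> =
     ((-1) ^ \<alpha> * p0) *\<^sub>R 1 + ((-1) ^ \<beta> * p1) *\<^sub>R i\<^sub>1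
     + (sqrt 3 / 2 * q0 - 1/2 * q1) *\<^sub>R i\<^sub>5 + (1/2 * q0 + sqrt 3 / 2 * q1) *\<^sub>R i\<^sub>6"
  by (simp add: oct_t_def oct_of_complex_def flip_signs_def eta_def octonion_defs)

lemma oct_u_coordinates:
  "oct_u (Complex e0 e1) (Complex f0 f1) \<alpha> \<beta> =
     ((-1) ^ \<alpha> * e0) *\<^sub>R 1 + ((-1) ^ \<beta> * e1) *\<^sub>R i\<^sub>1
     + (sqrt 3 / 2 * f0 - 1/2 * f1) *\<^sub>R i\<^sub>3 + (1/2 * f0 + sqrt 3 / 2 * f1) *\<^sub>R i\<^sub>7"
  by (simp add: oct_u_def oct_of_complex_def flip_signs_def eta_def octonion_defs)

end

theory Submission
  imports Defs
begin

text \<open>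
  The first rows of \<open>N\<^sup>* U\<close> and \<open>F\<^sup>* U\<close> are \<open>(A, B)\<close> and \<open>\<eta> (cnj B, - cnj A)\<close>, and by
  unitarity they determine the second rows. The amplitude of an outcome is therefore
  \<open>Re (c\<^sub>1 c\<^sub>2 c\<^sub>3) + \<i> Im (d\<^sub>1 d\<^sub>2 d\<^sub>3)\<close>, where \<open>(c\<^sub>k, d\<^sub>k)\<close> is the row belonging to player \<open>k\<close>.
  Writing \<open>B = \<eta> B'\<close> makes every \<open>d\<^sub>k\<close> a multiple of \<open>\<eta>\<close>, and \<open>\<eta>\<^sup>3 = -1\<close> removes \<open>\<eta>\<close> altogether.
  Up to signs, the real and imaginary parts of the amplitude are then the two octonion
  coordinates, since \<open>B'\<close> is also the coefficient that enters the octonion of a player.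
\<close>

lemma eta_mult_cnj: "eta * cnj eta = 1"
  by (simp add: eta_def complex_eq_iff)

lemma eta_cube: "eta * (eta * eta) = -1"
  by (simp add: eta_def complex_eq_iff algebra_simps)

definition su2_matrix :: "complex \<Rightarrow> complex \<Rightarrow> complex^2^2" where
  "su2_matrix a b = vector [vector [a, b], vector [- cnj b, cnj a]]"

text \<open>For \<open>U = su2_matrix a (eta * b)\<close> and the matrix \<open>M\<close> of the
  move \<open>X\<close>, the first row of \<open>M\<^sup>* U\<close> is
  \<open>(diag_entry X a b, eta * off_diag_entry X a b)\<close>.\<close>

fun diag_entry :: "move \<Rightarrow> complex \<Rightarrow> complex \<Rightarrow> complex" where
  "diag_entry NoFlip a b = a"
| "diag_entry Flip a b = cnj b"

fun off_diag_entry :: "move \<Rightarrow> complex \<Rightarrow> complex \<Rightarrow> complex" where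
  "off_diag_entry NoFlip a b = b"
| "off_diag_entry Flip a b = - cnj a"

lemma amplitude:
  "cinner (outcome_state X Y Z)
     (final_state (su2_matrix a (eta * b)) (su2_matrix p (eta * q)) (su2_matrix e (eta * f))) =
   Complex (Re (diag_entry X a b * diag_entry Y p q * diag_entry Z e f))
     (- Im (off_diag_entry X a b * off_diag_entry Y p q * off_diag_entry Z e f))"
proof -
  have cnj_cube: "cnj eta * (cnj eta * cnj eta) = -1"
    by (metis complex_cnj_minus complex_cnj_mult complex_cnj_one eta_cube)
  have eta_simps: "eta * (cnj eta * z) = z" "cnj eta * (eta * z) = z" "cnj eta * eta = 1"
      "eta * (eta * (eta * z)) = - z" "cnj eta * (cnj eta * (cnj eta * z)) = - z" for z
    using eta_mult_cnj eta_cube cnj_cube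
    by (metis mult.assoc mult.commute mult_1 mult_minus_left)+
  have eta_cancel: "eta * (x * (cnj eta * z)) = x * z" "eta * (x * (y * (cnj eta * z))) = x * (y * z)"
    for x y z
    using eta_simps by (metis mult.left_commute)+
  \<comment> \<open>With \<open>z\<close> and \<open>w\<close> the triple products in the statement,
    \<open>z\<close> and \<open>cnj z\<close> come from the 000-000 and 111-111 matrix elements,
    \<open>- w\<close> and \<open>cnj w\<close> from the two mixed ones, where \<open>eta\<close>
    enters cubed.\<close>
  have eq: "Complex (Re z) (- Im w) = (z + cnj z - w + cnj w) / 2" for z w
    by (simp add: complex_eq_iff)
  show ?thesis
    unfolding outcome_state_def cinner_final_state su2_matrix_def eq
    by (cases X; cases Y; cases Z;
        simp add: sum_qubits vector_2 eta_mult_cnj eta_cube cnj_cube eta_simps mult_ac;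
        simp add: algebra_simps eta_mult_cnj eta_cube cnj_cube eta_simps eta_cancel)
qed

lemma pr_su2_matrix:
  fixes A B P Q E F :: complex
  defines "B' \<equiv> B * cnj eta" and "Q' \<equiv> Q * cnj eta" and "F' \<equiv> F * cnj eta"
  shows "pr (su2_matrix A B) (su2_matrix P Q) (su2_matrix E F) X Y Z =
    (Re (diag_entry X A B' * diag_entry Y P Q' * diag_entry Z E F'))\<^sup>2 +
    (Im (off_diag_entry X A B' * off_diag_entry Y P Q' * off_diag_entry Z E F'))\<^sup>2"
proof -
  have eq: "eta * (z * cnj eta) = z" for z
    by (metis eta_mult_cnj mult.left_commute mult.right_neutral)
  have "su2_matrix A B = su2_matrix A (eta * B')" "su2_matrix P Q = su2_matrix P (eta * Q')"
      "su2_matrix E F = su2_matrix E (eta * F')"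
    unfolding B'_def Q'_def F'_def eq by simp_all
  thus ?thesis
    by (simp only: pr_def amplitude cmod_power2 complex.sel power2_minus)
qed

text \<open>The minus sign is that of \<open>i\<^sub>1 * i\<^sub>4 = - i\<^sub>2\<close>. Keeping
  \<open>B * cnj eta\<close> whole matches \<open>B'\<close> in
  \<open>pr_su2_matrix\<close>.\<close>

lemma oct_s_eq:
  "oct_s A B \<alpha> \<beta> =
     Octonion ((-1) ^ \<alpha> * Re A) ((-1) ^ \<beta> * Im A) (- Im (B * cnj eta)) 0 (Re (B * cnj eta)) 0 0 0"
  by (simp add: oct_s_def oct_of_complex_def flip_signs_def octonion_defs)

lemma oct_t_eq:
  "oct_t P Q \<alpha> \<beta> =
     Octonion ((-1) ^ \<alpha> * Re P) ((-1) ^ \<beta> * Im P) 0 0 0 (- Im (Q * cnj eta)) (Re (Q * cnj eta)) 0"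
  by (simp add: oct_t_def oct_of_complex_def flip_signs_def octonion_defs)

lemma oct_u_eq:
  "oct_u E F \<alpha> \<beta> =
     Octonion ((-1) ^ \<alpha> * Re E) ((-1) ^ \<beta> * Im E) 0 (- Im (F * cnj eta)) 0 0 0 (Re (F * cnj eta))"
  by (simp add: oct_u_def oct_of_complex_def flip_signs_def octonion_defs)

theorem theorem1:
  fixes A B P Q E F :: complex and U\<^sub>1 U\<^sub>2 U\<^sub>3 :: "complex^2^2"
  assumes "U\<^sub>1 = vector [vector [A, B], vector [- cnj B, cnj A]]"
    and "U\<^sub>2 = vector [vector [P, Q], vector [- cnj Q, cnj P]]"
    and "U\<^sub>3 = vector [vector [E, F], vector [- cnj F, cnj E]]"
    and "(cmod A)\<^sup>2 + (cmod B)\<^sup>2 = 1"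
    and "(cmod P)\<^sup>2 + (cmod Q)\<^sup>2 = 1"
    and "(cmod E)\<^sup>2 + (cmod F)\<^sup>2 = 1"
  shows "let s = oct_s A B; t = oct_t P Q; u = oct_u E F; p = pr U\<^sub>1 U\<^sub>2 U\<^sub>3 in
     p NoFlip NoFlip NoFlip =
       (\<pi>\<^sub>0 (((s 1 0 * t 1 0) * u 0 1 + (s 0 1 * t 1 0) * u 0 1) /\<^sub>R 2))\<^sup>2
       + (\<pi>\<^sub>0 (((s 1 0 * t 1 0) * u 0 1 - (s 0 1 * t 1 0) * u 0 1) /\<^sub>R 2))\<^sup>2
   \<and> p Flip Flip Flip =
       (\<pi>\<^sub>1 (((s 1 0 * t 1 0) * u 0 1 + (s 0 1 * t 1 0) * u 0 1) /\<^sub>R 2))\<^sup>2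
       + (\<pi>\<^sub>1 (((s 1 0 * t 1 0) * u 0 1 - (s 0 1 * t 1 0) * u 0 1) /\<^sub>R 2))\<^sup>2
   \<and> p NoFlip Flip Flip =
       (\<pi>\<^sub>2 (((s 0 1 * t 0 0) * u 0 0 + (s 1 0 * t 0 0) * u 0 0) /\<^sub>R 2))\<^sup>2
       + (\<pi>\<^sub>2 (((s 0 1 * t 0 0) * u 0 0 - (s 1 0 * t 0 0) * u 0 0) /\<^sub>R 2))\<^sup>2
   \<and> p Flip NoFlip NoFlip =
       (\<pi>\<^sub>4 (((s 0 1 * t 0 0) * u 0 0 + (s 1 0 * t 0 0) * u 0 0) /\<^sub>R 2))\<^sup>2
       + (\<pi>\<^sub>4 (((s 0 1 * t 0 0) * u 0 0 - (s 1 0 * t 0 0) * u 0 0) /\<^sub>R 2))\<^sup>2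
   \<and> p Flip NoFlip Flip =
       (\<pi>\<^sub>5 (((s 0 1 * t 0 0) * u 0 0 + (s 1 0 * t 0 0) * u 0 0) /\<^sub>R 2))\<^sup>2
       + (\<pi>\<^sub>5 (((s 0 1 * t 0 0) * u 0 0 - (s 1 0 * t 0 0) * u 0 0) /\<^sub>R 2))\<^sup>2
   \<and> p NoFlip Flip NoFlip =
       (\<pi>\<^sub>6 (((s 0 1 * t 0 0) * u 0 0 + (s 1 0 * t 0 0) * u 0 0) /\<^sub>R 2))\<^sup>2
       + (\<pi>\<^sub>6 (((s 0 1 * t 0 0) * u 0 0 - (s 1 0 * t 0 0) * u 0 0) /\<^sub>R 2))\<^sup>2
   \<and> p Flip Flip NoFlip =
       (\<pi>\<^sub>3 (((s 1 0 * t 1 0) * u 0 1 + (s 0 1 * t 1 0) * u 0 1) /\<^sub>R 2))\<^sup>2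
       + (\<pi>\<^sub>3 (((s 1 0 * t 1 0) * u 0 1 - (s 0 1 * t 1 0) * u 0 1) /\<^sub>R 2))\<^sup>2
   \<and> p NoFlip NoFlip Flip =
       (\<pi>\<^sub>7 (((s 1 0 * t 1 0) * u 0 1 + (s 0 1 * t 1 0) * u 0 1) /\<^sub>R 2))\<^sup>2
       + (\<pi>\<^sub>7 (((s 1 0 * t 1 0) * u 0 1 - (s 0 1 * t 1 0) * u 0 1) /\<^sub>R 2))\<^sup>2"
proof -
  have U: "U\<^sub>1 = su2_matrix A B" "U\<^sub>2 = su2_matrix P Q" "U\<^sub>3 = su2_matrix E F"
    using assms(1-3) by (simp_all add: su2_matrix_def)
  \<comment> \<open>Naming the coordinates of \<open>B * cnj eta\<close> instead of those of
    \<open>B\<close> keeps \<open>sqrt 3\<close> out of the polynomial identities.\<close>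
  obtain a0 a1 b0 b1 p0 p1 q0 q1 e0 e1 f0 f1
    where coords: "A = Complex a0 a1" "B * cnj eta = Complex b0 b1"
      "P = Complex p0 p1" "Q * cnj eta = Complex q0 q1"
      "E = Complex e0 e1" "F * cnj eta = Complex f0 f1"
    by (meson complex.exhaust)
  \<comment> \<open>Bilinearity reduces the half sum to the \<open>B\<close> part of
    \<open>s\<close> and the half difference to its \<open>A\<close> part, up to sign. As
    \<open>A\<close> and \<open>B\<close> never meet in one triple product, the two squares are
    those of the real and imaginary parts, in an order set by the move of player 1.\<close>
  show ?thesis
    unfolding Let_def U pr_su2_matrix oct_s_eq oct_t_eq oct_u_eq coords
    by (intro conjI; simp add: octonion_defs; simp add: field_simps power2_eq_square)
qed

end
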